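(* Let $\mathfrak{A}$ be a JB$^*$-algebra. Then $\mathfrak{A}$ is dense in its multipliers algebra $M(\mathfrak{A})$ with respect to the J-strict topology $S(M(\mathfrak{A}),\mathfrak{A})$.
   Context: A JB$^*$-algebra is a complex Banach space $\mathfrak{A}$ with a commutative bilinear product $\circ$ satisfying the Jordan identity $(x\circ y)\circ x^2 = x\circ(y\circ x^2)$, with $\|a\circ b\|\le\|a\|\,\|b\|$, and with a conjugate-linear algebra involution $^*$ such that $\|U_a(a^* )\|=\|a\|^3$ for all $a$, where $U_a(b)=2(a\circ b)\circ a-a^2\circ b$. The bidual $\mathfrak{A}^{**}$ is a unital JB$^*$-algebra (a JBW$^*$-algebra) whose product and involution extend those of $\mathfrak{A}$ and whose product is separately weak$^*$ continuous. The multipliers algebra is $M(\mathfrak{A})=\{x\in\mathfrak{A}^{**}: x\circ\mathfrak{A}\subseteq\mathfrak{A}\}$, a unital JB$^*$-subalgebra of $\mathfrak{A}^{**}$ containing $\mathfrak{A}$ as a closed Jordan ideal. The J-strict topology $S(M(\mathfrak{A}),\mathfrak{A})$ is the locally convex topology on $M(\mathfrak{A})$ generated by the seminorms $\rho_a(z)=\|z\circ a\|$, $a\in\mathfrak{A}$. *)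

theory Defs
  imports "HOL-Analysis.Analysis"
begin

section \<open>Complex normed spaces and their duals\<close>

class complex_normed_vector = real_normed_vector +
  fixes scaleC :: "complex \<Rightarrow> 'a \<Rightarrow> 'a"  (infixr \<open>*\<^sub>C\<close> 75)
  assumes scaleC_add_right: "c *\<^sub>C (x + y) = c *\<^sub>C x + c *\<^sub>C y"
    and scaleC_add_left: "(c + d) *\<^sub>C x = c *\<^sub>C x + d *\<^sub>C x"
    and scaleC_scaleC: "c *\<^sub>C d *\<^sub>C x = (c * d) *\<^sub>C x"
    and scaleR_scaleC: "r *\<^sub>R x = complex_of_real r *\<^sub>C x"
    and norm_scaleC: "norm (c *\<^sub>C x) = cmod c * norm x"

class complex_banach = complex_normed_vector + banach

text \<open>The dual consists of the bounded \<^emph>\<open>complex\<close>-linear functionals, with the operator norm.\<close>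

typedef (overloaded) 'a cdual =
  "{f :: 'a::complex_normed_vector \<Rightarrow>\<^sub>L complex. \<forall>c x. f (c *\<^sub>C x) = c * f x}"
  by (intro exI[of _ 0]) simp

setup_lifting type_definition_cdual

lift_definition cdual_apply :: "'a::complex_normed_vector cdual \<Rightarrow> 'a \<Rightarrow> complex"
  is blinfun_apply .

instantiation cdual :: (complex_normed_vector) complex_normed_vector
begin

lift_definition zero_cdual :: "'a cdual" is 0 by simp
lift_definition plus_cdual :: "'a cdual \<Rightarrow> 'a cdual \<Rightarrow> 'a cdual" is "(+)"
  by (simp add: blinfun.add_left algebra_simps)
lift_definition minus_cdual :: "'a cdual \<Rightarrow> 'a cdual \<Rightarrow> 'a cdual" is "(-)"
  by (simp add: blinfun.diff_left algebra_simps)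
lift_definition uminus_cdual :: "'a cdual \<Rightarrow> 'a cdual" is uminus
  by (simp add: blinfun.minus_left)
lift_definition scaleR_cdual :: "real \<Rightarrow> 'a cdual \<Rightarrow> 'a cdual" is scaleR
  by (simp add: blinfun.scaleR_left)
lift_definition scaleC_cdual :: "complex \<Rightarrow> 'a cdual \<Rightarrow> 'a cdual"
  is "\<lambda>c f. blinfun_mult_right c o\<^sub>L f"
  by simp
lift_definition norm_cdual :: "'a cdual \<Rightarrow> real" is norm .

definition dist_cdual :: "'a cdual \<Rightarrow> 'a cdual \<Rightarrow> real"
  where "dist_cdual f g = norm (f - g)"
definition sgn_cdual :: "'a cdual \<Rightarrow> 'a cdual"
  where "sgn_cdual f = scaleR (inverse (norm f)) f"
definition uniformity_cdual :: "('a cdual \<times> 'a cdual) filter"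
  where "uniformity_cdual = (INF e\<in>{0 <..}. principal {(f, g). dist f g < e})"
definition open_cdual :: "'a cdual set \<Rightarrow> bool"
  where "open_cdual U = (\<forall>f\<in>U. eventually (\<lambda>(f', g). f' = f \<longrightarrow> g \<in> U) uniformity)"

instance
proof
  show "norm (c *\<^sub>C f) = cmod c * norm f" for c and f :: "'a cdual"
  proof transfer
    fix c :: complex and f :: "'a \<Rightarrow>\<^sub>L complex"
    show "norm (blinfun_mult_right c o\<^sub>L f) = cmod c * norm f"
    proof (cases "c = 0")
      case True
      have "blinfun_mult_right c o\<^sub>L f = 0"
        by (rule blinfun_eqI) (simp add: True)
      then show ?thesis using True by simp
    next
      case False
      have le: "norm (blinfun_mult_right c o\<^sub>L f) \<le> cmod c * norm f"
        for c and f :: "'a \<Rightarrow>\<^sub>L complex"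
        by (rule norm_blinfun_bound)
          (auto simp: norm_mult mult.assoc intro!: mult_left_mono norm_blinfun)
      have "f = blinfun_mult_right (inverse c) o\<^sub>L (blinfun_mult_right c o\<^sub>L f)"
        by (rule blinfun_eqI) (simp add: False)
      then have "norm f \<le> cmod (inverse c) * norm (blinfun_mult_right c o\<^sub>L f)"
        using le by metis
      then have "cmod c * norm f \<le> norm (blinfun_mult_right c o\<^sub>L f)"
        using False by (simp add: norm_divide field_simps)
      then show ?thesis using le[of c f] by simp
    qed
  qed
next
  fix f g h :: "'a cdual" and r s :: real and c d :: complex
  show "dist f g = norm (f - g)" by (rule dist_cdual_def)
  show "sgn f = inverse (norm f) *\<^sub>R f" by (rule sgn_cdual_def)
  show "(norm f = 0) = (f = 0)" by transfer simp
  show "norm (f + g) \<le> norm f + norm g" by transfer (rule norm_triangle_ineq)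
  show "norm (r *\<^sub>R f) = \<bar>r\<bar> * norm f" by transfer simp
  show "r *\<^sub>R f = complex_of_real r *\<^sub>C f"
    by transfer (rule blinfun_eqI, simp add: blinfun.scaleR_left scaleR_conv_of_real)
  show "c *\<^sub>C (f + g) = c *\<^sub>C f + c *\<^sub>C g"
    by transfer (rule blinfun_eqI, simp add: blinfun.add_left algebra_simps)
  show "(c + d) *\<^sub>C f = c *\<^sub>C f + d *\<^sub>C f"
    by transfer (rule blinfun_eqI, simp add: blinfun.add_left algebra_simps)
  show "c *\<^sub>C d *\<^sub>C f = (c * d) *\<^sub>C f"
    by transfer (rule blinfun_eqI, simp)
  show "(uniformity :: ('a cdual \<times> 'a cdual) filter) =
      (INF e\<in>{0 <..}. principal {(f, g). dist f g < e})"
    by (rule uniformity_cdual_def)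
  show "open U = (\<forall>f\<in>U. eventually (\<lambda>(f', g). f' = f \<longrightarrow> g \<in> U) uniformity)"
    for U :: "'a cdual set"
    by (rule open_cdual_def)
  show "f + g + h = f + (g + h)" by transfer (rule add.assoc)
  show "f + g = g + f" by transfer (rule add.commute)
  show "0 + f = f" by transfer simp
  show "- f + f = 0" by transfer simp
  show "f - g = f + - g" by transfer simp
  show "r *\<^sub>R (f + g) = r *\<^sub>R f + r *\<^sub>R g" by transfer (rule scaleR_add_right)
  show "(r + s) *\<^sub>R f = r *\<^sub>R f + s *\<^sub>R f" by transfer (rule scaleR_add_left)
  show "r *\<^sub>R s *\<^sub>R f = (r * s) *\<^sub>R f" by transfer simp
  show "1 *\<^sub>R f = f" by transfer simp
qed

end

type_synonym 'a bidual = "'a cdual cdual"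

definition complex_linear_functional :: "('a::complex_normed_vector \<Rightarrow> complex) \<Rightarrow> bool"
  where "complex_linear_functional f \<longleftrightarrow>
    (\<forall>x y. f (x + y) = f x + f y) \<and> (\<forall>c x. f (c *\<^sub>C x) = c * f x)"

text \<open>The functional with underlying map \<open>f\<close>; meaningful only if \<open>f\<close> is complex-linear and
  bounded, see \<open>cdual_apply_Cdual\<close>.\<close>

definition Cdual :: "('a::complex_normed_vector \<Rightarrow> complex) \<Rightarrow> 'a cdual"
  where "Cdual f = Abs_cdual (Blinfun f)"

lemma cdual_apply_Cdual:
  assumes "complex_linear_functional f" and "\<And>x. cmod (f x) \<le> K * norm x"
  shows "cdual_apply (Cdual f) = f"
proof -
  have "bounded_linear f"
    using assms
    by (intro bounded_linear_intro[where K = K])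
      (auto simp: complex_linear_functional_def scaleR_scaleC scaleR_conv_of_real mult.commute)
  then show ?thesis
    using assms(1)
    by (simp add: Cdual_def cdual_apply_def Abs_cdual_inverse bounded_linear_Blinfun_apply
        complex_linear_functional_def)
qed

lemma cdual_eqI: "(\<And>x. cdual_apply f x = cdual_apply g x) \<Longrightarrow> f = g"
  by transfer (simp add: blinfun_eqI)

lemma
  shows cdual_apply_add_left: "cdual_apply (f + g) x = cdual_apply f x + cdual_apply g x"
    and cdual_apply_scaleC_left: "cdual_apply (c *\<^sub>C f) x = c * cdual_apply f x"
    and cdual_apply_diff_left: "cdual_apply (f - g) x = cdual_apply f x - cdual_apply g x"
    and cdual_apply_zero_left: "cdual_apply 0 x = 0"
  by (transfer; simp add: blinfun.bilinear_simps)+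

lemma
  shows cdual_apply_add_right: "cdual_apply f (x + y) = cdual_apply f x + cdual_apply f y"
    and cdual_apply_scaleC_right: "cdual_apply f (c *\<^sub>C x) = c * cdual_apply f x"
    and cdual_apply_diff_right: "cdual_apply f (x - y) = cdual_apply f x - cdual_apply f y"
    and cdual_apply_zero_right: "cdual_apply f 0 = 0"
  by (transfer; simp add: blinfun.bilinear_simps)+

lemmas cdual_simps =
  cdual_apply_add_left cdual_apply_scaleC_left cdual_apply_diff_left cdual_apply_zero_left
  cdual_apply_add_right cdual_apply_scaleC_right cdual_apply_diff_right cdual_apply_zero_right

lemma norm_cdual_apply: "cmod (cdual_apply f x) \<le> norm f * norm x"
  by transfer (rule norm_blinfun)

lemma norm_cdual_bound:
  "0 \<le> K \<Longrightarrow> (\<And>x. cmod (cdual_apply f x) \<le> K * norm x) \<Longrightarrow> norm f \<le> K"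
  by transfer (rule norm_blinfun_bound)

definition bidual_embed :: "'a::complex_normed_vector \<Rightarrow> 'a bidual"
  where "bidual_embed x = Cdual (\<lambda>f. cdual_apply f x)"

lemma bidual_embed_apply [simp]:
  "cdual_apply (bidual_embed x) f = cdual_apply f x"
  unfolding bidual_embed_def
  by (subst cdual_apply_Cdual[where K = "norm x"])
    (use norm_cdual_apply in \<open>auto simp: complex_linear_functional_def cdual_simps mult.commute\<close>)

definition weak_star_topology :: "'a::complex_normed_vector cdual topology"
  where "weak_star_topology = pullback_topology UNIV cdual_apply euclidean"


section \<open>JB*-algebras\<close>

class jordan_banach_algebra = complex_banach +
  fixes jordan_prod :: "'a \<Rightarrow> 'a \<Rightarrow> 'a"  (infixl \<open>\<circ>\<^sub>J\<close> 70)
  assumes jordan_prod_commute: "x \<circ>\<^sub>J y = y \<circ>\<^sub>J x"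
    and jordan_prod_add_left: "(x + y) \<circ>\<^sub>J z = x \<circ>\<^sub>J z + y \<circ>\<^sub>J z"
    and jordan_prod_scaleC_left: "(c *\<^sub>C x) \<circ>\<^sub>J y = c *\<^sub>C (x \<circ>\<^sub>J y)"
    and jordan_identity: "(x \<circ>\<^sub>J y) \<circ>\<^sub>J (x \<circ>\<^sub>J x) = x \<circ>\<^sub>J (y \<circ>\<^sub>J (x \<circ>\<^sub>J x))"
    and norm_jordan_prod: "norm (x \<circ>\<^sub>J y) \<le> norm x * norm y"
begin

definition U_op :: "'a \<Rightarrow> 'a \<Rightarrow> 'a"
  where "U_op a b = 2 *\<^sub>R ((a \<circ>\<^sub>J b) \<circ>\<^sub>J a) - (a \<circ>\<^sub>J a) \<circ>\<^sub>J b"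

end

class jb_star_algebra = jordan_banach_algebra +
  fixes invol :: "'a \<Rightarrow> 'a"
  assumes invol_add: "invol (x + y) = invol x + invol y"
    and invol_scaleC: "invol (c *\<^sub>C x) = cnj c *\<^sub>C invol x"
    and invol_invol: "invol (invol x) = x"
    and invol_jordan_prod: "invol (x \<circ>\<^sub>J y) = invol x \<circ>\<^sub>J invol y"
    and norm_U_op_invol: "norm (U_op a (invol a)) = norm a ^ 3"


section \<open>The product of the bidual\<close>

text \<open>The product of the bidual is the Arens extension
  \<open>(x \<circ> y)(f) = x(y \<cdot> f)\<close>, where \<open>(y \<cdot> f)(a) = y(f \<cdot> a)\<close> and
  \<open>(f \<cdot> a)(b) = f(a \<circ> b)\<close>. JB*-algebras are Arens regular, so this is the JBW*-algebra product
  of the bidual; that no other product extends that of the algebra and is separately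
  weak*-continuous is \<open>bidual_prod_unique\<close>.\<close>

definition dual_act :: "'a::jb_star_algebra cdual \<Rightarrow> 'a \<Rightarrow> 'a cdual"
  where "dual_act f a = Cdual (\<lambda>b. cdual_apply f (a \<circ>\<^sub>J b))"

definition bidual_act :: "'a::jb_star_algebra bidual \<Rightarrow> 'a cdual \<Rightarrow> 'a cdual"
  where "bidual_act y f = Cdual (\<lambda>a. cdual_apply y (dual_act f a))"

definition bidual_prod :: "'a::jb_star_algebra bidual \<Rightarrow> 'a bidual \<Rightarrow> 'a bidual"
    (infixl \<open>\<circ>\<^sub>B\<close> 70)
  where "x \<circ>\<^sub>B y = Cdual (\<lambda>f. cdual_apply x (bidual_act y f))"

lemma dual_act_apply [simp]:
  "cdual_apply (dual_act f a) b = cdual_apply f (a \<circ>\<^sub>J b)"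
proof -
  have lin: "complex_linear_functional (\<lambda>b. cdual_apply f (a \<circ>\<^sub>J b))"
    by (simp add: complex_linear_functional_def cdual_simps jordan_prod_commute[of a]
        jordan_prod_add_left jordan_prod_scaleC_left)
  have "cmod (cdual_apply f (a \<circ>\<^sub>J b)) \<le> norm f * norm a * norm b" for b
    using norm_cdual_apply[of f "a \<circ>\<^sub>J b"]
      mult_left_mono[OF norm_jordan_prod[of a b] norm_ge_zero[of f]]
    by (simp add: mult.assoc)
  then show ?thesis
    unfolding dual_act_def by (subst cdual_apply_Cdual[OF lin]) auto
qed

lemma norm_dual_act: "norm (dual_act f a) \<le> norm f * norm a"
proof (rule norm_cdual_bound)
  show "cmod (cdual_apply (dual_act f a) b) \<le> norm f * norm a * norm b" for b
    using norm_cdual_apply[of f "a \<circ>\<^sub>J b"]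
      mult_left_mono[OF norm_jordan_prod[of a b] norm_ge_zero[of f]]
    by (simp add: mult.assoc)
qed simp

lemma dual_act_linear:
  "dual_act f (a + b) = dual_act f a + dual_act f b"
  "dual_act f (c *\<^sub>C a) = c *\<^sub>C dual_act f a"
  "dual_act (f + g) a = dual_act f a + dual_act g a"
  "dual_act (c *\<^sub>C f) a = c *\<^sub>C dual_act f a"
  by (rule cdual_eqI; simp add: cdual_simps jordan_prod_add_left jordan_prod_scaleC_left)+

lemma bidual_act_bound:
  "cmod (cdual_apply y (dual_act f a)) \<le> norm y * norm f * norm a"
  using norm_cdual_apply[of y "dual_act f a"]
    mult_left_mono[OF norm_dual_act[of f a] norm_ge_zero[of y]]
  by (simp add: mult.assoc)

lemma bidual_act_apply [simp]:
  "cdual_apply (bidual_act y f) a = cdual_apply y (dual_act f a)"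
proof -
  have "complex_linear_functional (\<lambda>a. cdual_apply y (dual_act f a))"
    by (simp add: complex_linear_functional_def cdual_simps dual_act_linear)
  from cdual_apply_Cdual[OF this bidual_act_bound] show ?thesis
    unfolding bidual_act_def by simp
qed

lemma norm_bidual_act: "norm (bidual_act y f) \<le> norm y * norm f"
  by (rule norm_cdual_bound) (simp_all add: bidual_act_bound)

lemma bidual_act_linear:
  "bidual_act y (f + g) = bidual_act y f + bidual_act y g"
  "bidual_act y (c *\<^sub>C f) = c *\<^sub>C bidual_act y f"
  by (rule cdual_eqI; simp add: cdual_simps dual_act_linear)+

lemma bidual_prod_apply [simp]:
  "cdual_apply (x \<circ>\<^sub>B y) f = cdual_apply x (bidual_act y f)"
proof -
  have lin: "complex_linear_functional (\<lambda>f. cdual_apply x (bidual_act y f))"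
    by (simp add: complex_linear_functional_def cdual_simps bidual_act_linear)
  have "cmod (cdual_apply x (bidual_act y f)) \<le> norm x * norm y * norm f" for f
    using norm_cdual_apply[of x "bidual_act y f"]
      mult_left_mono[OF norm_bidual_act[of y f] norm_ge_zero[of x]]
    by (simp add: mult.assoc)
  then show ?thesis
    unfolding bidual_prod_def by (subst cdual_apply_Cdual[OF lin]) auto
qed

lemma bidual_prod_embed: "bidual_embed a \<circ>\<^sub>B bidual_embed b = bidual_embed (a \<circ>\<^sub>J b)"
  by (rule cdual_eqI) simp

lemma continuous_map_weak_star_eval:
  "continuous_map weak_star_topology euclidean (\<lambda>f. cdual_apply f x)"
proof -
  have "continuous_map weak_star_topology euclidean ((\<lambda>g. g x) \<circ> cdual_apply)"
    unfolding weak_star_topology_def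
    by (rule continuous_map_pullback) (simp add: continuous_on_product_coordinates)
  then show ?thesis by (simp add: o_def)
qed

lemma continuous_map_into_weak_star:
  assumes "\<And>x. continuous_map X euclidean (\<lambda>t. cdual_apply (h t) x)"
  shows "continuous_map X weak_star_topology h"
  unfolding weak_star_topology_def
proof (rule continuous_map_pullback')
  show "continuous_map X euclidean (cdual_apply \<circ> h)"
    using assms
    by (simp add: o_def continuous_map_componentwise_UNIV flip: euclidean_product_topology)
qed auto

text \<open>The Arens product is weak*-continuous in its first variable, and in its second one
  when the first lies in the algebra.\<close>

lemma bidual_prod_weak_star_left:
  "continuous_map weak_star_topology weak_star_topology (\<lambda>x. x \<circ>\<^sub>B y)"
  by (rule continuous_map_into_weak_star) (simp add: continuous_map_weak_star_eval)

lemma bidual_prod_embed_weak_star_right: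
  "continuous_map weak_star_topology weak_star_topology (\<lambda>y. bidual_embed a \<circ>\<^sub>B y)"
  by (rule continuous_map_into_weak_star) (simp add: continuous_map_weak_star_eval)

lemma cdual_joint_kernel:
  assumes "finite F"
    and "\<And>x. \<forall>f\<in>F. cdual_apply f x = 0 \<Longrightarrow> cdual_apply g x = 0"
    and "\<forall>f\<in>F. cdual_apply z f = 0"
  shows "cdual_apply z g = 0"
  using assms
proof (induction F arbitrary: g rule: finite_induct)
  case empty
  then have "g = 0" by (intro cdual_eqI) (simp add: cdual_simps)
  then show ?case by (simp add: cdual_simps)
next
  case (insert h F)
  show ?case
  proof (cases "\<forall>x. (\<forall>f\<in>F. cdual_apply f x = 0) \<longrightarrow> cdual_apply h x = 0")
    case True
    then show ?thesis using insert.IH[of g] insert.prems by auto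
  next
    case False
    then obtain v where v: "\<forall>f\<in>F. cdual_apply f v = 0" "cdual_apply h v \<noteq> 0" by auto
    define c where "c = cdual_apply g v / cdual_apply h v"
    have "cdual_apply (g - c *\<^sub>C h) x = 0" if "\<forall>f\<in>F. cdual_apply f x = 0" for x
    proof -
      let ?w = "x - (cdual_apply h x / cdual_apply h v) *\<^sub>C v"
      have "cdual_apply g ?w = 0"
        using that v by (intro insert.prems(1)) (auto simp: cdual_simps)
      then show ?thesis by (simp add: cdual_simps c_def)
    qed
    then have "cdual_apply z (g - c *\<^sub>C h) = 0"
      using insert.IH[of "g - c *\<^sub>C h"] insert.prems(2) by auto
    then show ?thesis using insert.prems(2) by (simp add: cdual_simps)
  qed
qed

lemma bidual_interpolation:
  assumes "finite F"
  shows "\<exists>x. \<forall>f\<in>F. cdual_apply f x = cdual_apply z f"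
  using assms
proof (induction F rule: finite_induct)
  case (insert g F)
  then obtain x where x: "\<forall>f\<in>F. cdual_apply f x = cdual_apply z f" by blast
  show ?case
  proof (cases "\<forall>u. (\<forall>f\<in>F. cdual_apply f u = 0) \<longrightarrow> cdual_apply g u = 0")
    case True
    have "cdual_apply (z - bidual_embed x) g = 0"
      by (rule cdual_joint_kernel[OF insert.hyps(1)]) (use True x in \<open>auto simp: cdual_simps\<close>)
    then show ?thesis using x by (intro exI[of _ x]) (simp add: cdual_simps)
  next
    case False
    then obtain v where v: "\<forall>f\<in>F. cdual_apply f v = 0" "cdual_apply g v \<noteq> 0" by auto
    let ?y = "x + ((cdual_apply z g - cdual_apply g x) / cdual_apply g v) *\<^sub>C v"
    show ?thesis using x v by (intro exI[of _ ?y]) (auto simp: cdual_simps)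
  qed
qed simp

lemma bidual_embed_weak_star_dense:
  "weak_star_topology closure_of range bidual_embed = UNIV"
proof -
  have "\<exists>y. y \<in> range bidual_embed \<and> y \<in> T"
    if z: "z \<in> T" and T: "openin weak_star_topology T" for z :: "'a bidual" and T
  proof -
    obtain U where U: "open U" "T = cdual_apply -` U"
      using T by (auto simp: weak_star_topology_def openin_pullback_topology)
    have "openin (product_topology (\<lambda>_. euclidean) UNIV) U"
      using U(1) by (simp add: euclidean_product_topology)
    then obtain V where V: "finite {f. V f \<noteq> UNIV}" "cdual_apply z \<in> Pi UNIV V" "Pi UNIV V \<subseteq> U"
      using z U(2) by (fastforce simp: openin_product_topology_alt PiE_UNIV_domain)
    obtain x where x: "\<forall>f\<in>{f. V f \<noteq> UNIV}. cdual_apply f x = cdual_apply z f"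
      using bidual_interpolation[OF V(1)] by blast
    have "cdual_apply (bidual_embed x) f \<in> V f" for f
      using x V(2) by (cases "V f = UNIV") (auto simp: Pi_iff)
    then show ?thesis using U(2) V(3) by blast
  qed
  moreover have "topspace (weak_star_topology :: 'a bidual topology) = UNIV"
    by (simp add: weak_star_topology_def topspace_pullback_topology)
  ultimately show ?thesis by (auto simp: in_closure_of)
qed

lemma weak_star_eq_on_bidual:
  assumes "continuous_map weak_star_topology weak_star_topology h"
    and "continuous_map weak_star_topology weak_star_topology k"
    and "\<And>a. h (bidual_embed a) = k (bidual_embed a)"
  shows "h z = (k z :: 'b::complex_normed_vector cdual)"
proof (rule cdual_eqI)
  fix f
  have c: "continuous_map weak_star_topology euclidean (\<lambda>z. cdual_apply (h z) f)"
    "continuous_map weak_star_topology euclidean (\<lambda>z. cdual_apply (k z) f)"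
    using continuous_map_compose[OF assms(1) continuous_map_weak_star_eval]
      continuous_map_compose[OF assms(2) continuous_map_weak_star_eval]
    by (simp_all add: o_def)
  show "cdual_apply (h z) f = cdual_apply (k z) f"
    by (rule forall_in_closure_of_eq[OF _ _ c])
      (use assms(3) bidual_embed_weak_star_dense in auto)
qed

theorem bidual_prod_unique:
  fixes P :: "'a::jb_star_algebra bidual \<Rightarrow> 'a bidual \<Rightarrow> 'a bidual"
  assumes extends: "\<And>a b. P (bidual_embed a) (bidual_embed b) = bidual_embed (a \<circ>\<^sub>J b)"
    and "\<And>y. continuous_map weak_star_topology weak_star_topology (\<lambda>x. P x y)"
    and "\<And>x. continuous_map weak_star_topology weak_star_topology (P x)"
  shows "P x y = x \<circ>\<^sub>B y"
proof -
  have "P (bidual_embed a) y = bidual_embed a \<circ>\<^sub>B y" for a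
    by (rule weak_star_eq_on_bidual[OF assms(3) bidual_prod_embed_weak_star_right])
      (simp add: extends bidual_prod_embed)
  then show ?thesis
    by (rule weak_star_eq_on_bidual[OF assms(2) bidual_prod_weak_star_left])
qed


section \<open>Multipliers and the J-strict topology\<close>

definition multiplier_algebra :: "'a::jb_star_algebra bidual set"
  where "multiplier_algebra = {x. \<forall>a. x \<circ>\<^sub>B bidual_embed a \<in> range bidual_embed}"

lemma range_bidual_embed_subset_multiplier_algebra:
  "range bidual_embed \<subseteq> multiplier_algebra"
  by (auto simp: multiplier_algebra_def bidual_prod_embed)

text \<open>The locally convex topology induced on \<open>S\<close> by a family of seminorms \<open>\<rho>\<close>.\<close>

definition seminorm_topology_on ::
    "'v::real_vector set \<Rightarrow> ('i \<Rightarrow> 'v \<Rightarrow> real) \<Rightarrow> 'v topology"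
  where "seminorm_topology_on S \<rho> = topology (\<lambda>U. U \<subseteq> S \<and>
    (\<forall>x\<in>U. \<exists>F \<epsilon>. finite F \<and> \<epsilon> > 0 \<and> {y \<in> S. \<forall>i\<in>F. \<rho> i (y - x) < \<epsilon>} \<subseteq> U))"

lemma openin_seminorm_topology_on:
  "openin (seminorm_topology_on S \<rho>) U \<longleftrightarrow> U \<subseteq> S \<and>
    (\<forall>x\<in>U. \<exists>F \<epsilon>. finite F \<and> \<epsilon> > 0 \<and> {y \<in> S. \<forall>i\<in>F. \<rho> i (y - x) < \<epsilon>} \<subseteq> U)"
proof -
  let ?N = "\<lambda>x F \<epsilon>. {y \<in> S. \<forall>i\<in>F. \<rho> i (y - x) < \<epsilon>}"
  let ?O = "\<lambda>U. U \<subseteq> S \<and> (\<forall>x\<in>U. \<exists>F \<epsilon>. finite F \<and> \<epsilon> > 0 \<and> ?N x F \<epsilon> \<subseteq> U)"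
  have "istopology ?O"
    unfolding istopology_def
  proof (intro conjI allI impI ballI)
    fix U V x assume U: "?O U" and V: "?O V" and x: "x \<in> U \<inter> V"
    obtain F \<delta> where 1: "finite F" "\<delta> > 0" "?N x F \<delta> \<subseteq> U" using U x by blast
    obtain G \<epsilon> where 2: "finite G" "\<epsilon> > 0" "?N x G \<epsilon> \<subseteq> V" using V x by blast
    have "?N x (F \<union> G) (min \<delta> \<epsilon>) \<subseteq> U \<inter> V" using 1(3) 2(3) by auto
    then show "\<exists>F \<epsilon>. finite F \<and> \<epsilon> > 0 \<and> ?N x F \<epsilon> \<subseteq> U \<inter> V"
      using 1 2 by (intro exI[of _ "F \<union> G"] exI[of _ "min \<delta> \<epsilon>"]) auto
  next
    fix K x assume K: "\<forall>U\<in>K. ?O U" and "x \<in> \<Union>K"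
    then obtain U where U: "U \<in> K" "x \<in> U" by blast
    have "?O U" using K U(1) by (rule bspec)
    then obtain F \<epsilon> where N: "finite F" "\<epsilon> > 0" "?N x F \<epsilon> \<subseteq> U" using U(2) by meson
    have "?N x F \<epsilon> \<subseteq> \<Union>K" using N(3) Union_upper[OF U(1)] by (rule subset_trans)
    then show "\<exists>F \<epsilon>. finite F \<and> \<epsilon> > 0 \<and> ?N x F \<epsilon> \<subseteq> \<Union>K" using N(1,2) by blast
  next
    show "U \<inter> V \<subseteq> S" if "?O U" "?O V" for U V using that by (meson inf.coboundedI1)
    show "\<Union>K \<subseteq> S" if "\<forall>U\<in>K. ?O U" for K using that by (meson Union_least)
  qed
  then show ?thesis by (simp add: seminorm_topology_on_def topology_inverse')
qed

lemma topspace_seminorm_topology_on [simp]: "topspace (seminorm_topology_on S \<rho>) = S"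
proof
  show "topspace (seminorm_topology_on S \<rho>) \<subseteq> S"
    using openin_topspace[of "seminorm_topology_on S \<rho>"]
    by (simp only: openin_seminorm_topology_on)
  have "openin (seminorm_topology_on S \<rho>) S"
    unfolding openin_seminorm_topology_on using finite.emptyI zero_less_one by blast
  then show "S \<subseteq> topspace (seminorm_topology_on S \<rho>)" by (rule openin_subset)
qed

definition J_strict_topology :: "'a::jb_star_algebra bidual topology"
  where "J_strict_topology =
    seminorm_topology_on multiplier_algebra (\<lambda>a z. norm (z \<circ>\<^sub>B bidual_embed a))"

end

theory Submission
  imports Defs
begin

text \<open>Why the algebra is J-strictly dense. Fix a multiplier \<open>z\<close>, finitely many elements
  \<open>a \<in> F\<close> of the algebra and consider the seminorm \<open>u \<mapsto> \<Sum>a\<in>F. norm (u \<circ> a)\<close> on the bidual.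
  If the algebra kept a positive distance from \<open>z\<close> in this seminorm, the Hahn-Banach theorem would
  give a real-linear functional \<open>f\<close>, dominated by the seminorm, that vanishes on the algebra but
  not at \<open>z\<close>. Such an \<open>f\<close> splits as \<open>f u = \<Sum>a\<in>F. g a (u \<circ> a)\<close> with each \<open>g a\<close> dominated by
  the norm (\<open>linear_dominated_by_sum_splits\<close>). Because \<open>z\<close> is a multiplier, every \<open>z \<circ> a\<close> lies
  in the algebra, so \<open>f z\<close> depends only on the restrictions of the \<open>g a\<close> to the algebra. These are
  real parts of members of the dual, and therefore \<open>f z\<close> is the real part of \<open>z\<close> evaluated at a
  single functional \<open>\<psi>\<close>, whose real part on the algebra is \<open>f\<close>. But \<open>f\<close> vanishes there, so
  \<open>\<psi> = 0\<close> and \<open>f z = 0\<close>: a contradiction. In other words, J-strictly continuous functionals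
  on the multiplier algebra are weak*-continuous there, and the algebra is weak*-dense in its
  bidual.

  The Hahn-Banach theorem is obtained in the form \<open>Hahn_Banach_cone\<close>, from which the separation
  and the splitting both follow by choosing a cone of constraints. Its proof takes a minimal
  sublinear functional below a given one, by Zorn's lemma, and shows that minimality forces
  linearity.\<close>

section \<open>The Hahn-Banach theorem\<close>

text \<open>The inequality for positive scalars already gives equality, and the value 0 at 0.\<close>

definition sublinear :: "('v::real_vector \<Rightarrow> real) \<Rightarrow> bool"
  where "sublinear p \<longleftrightarrow>
    (\<forall>x y. p (x + y) \<le> p x + p y) \<and> (\<forall>c x. c > 0 \<longrightarrow> p (c *\<^sub>R x) \<le> c * p x)"

lemma sublinear_add: "sublinear p \<Longrightarrow> p (x + y) \<le> p x + p y"
  by (simp add: sublinear_def)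

lemma sublinear_scaleR_le: "sublinear p \<Longrightarrow> c > 0 \<Longrightarrow> p (c *\<^sub>R x) \<le> c * p x"
  by (simp add: sublinear_def)

lemma sublinear_scaleR:
  assumes "sublinear p" and "c > 0"
  shows "p (c *\<^sub>R x) = c * p x"
proof (rule antisym)
  have "p (inverse c *\<^sub>R c *\<^sub>R x) \<le> inverse c * p (c *\<^sub>R x)"
    using assms by (intro sublinear_scaleR_le) auto
  then show "c * p x \<le> p (c *\<^sub>R x)" using assms(2) by (simp add: field_simps)
qed (use assms in \<open>rule sublinear_scaleR_le\<close>)

lemma sublinear_zero: "sublinear p \<Longrightarrow> p 0 = 0"
  using sublinear_scaleR[of p 2 0] by simp

lemma sublinear_minus: "sublinear p \<Longrightarrow> - p (- x) \<le> p x"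
  using sublinear_add[of p x "- x"] by (simp add: sublinear_zero)

lemma sublinear_norm_linear:
  fixes T :: "'v::real_vector \<Rightarrow> 'w::real_normed_vector"
  assumes "linear T"
  shows "sublinear (\<lambda>x. norm (T x))"
  unfolding sublinear_def
  by (simp add: linear_add[OF assms] linear_scale[OF assms] norm_triangle_ineq)

lemma sublinear_sum:
  assumes "\<And>i. i \<in> I \<Longrightarrow> sublinear (p i)"
  shows "sublinear (\<lambda>x. \<Sum>i\<in>I. p i x)"
  using assms unfolding sublinear_def sum.distrib[symmetric] sum_distrib_left
  by (auto intro!: sum_mono)

lemma sublinear_odd_imp_linear:
  assumes p: "sublinear p" and odd: "\<And>x. p (- x) = - p x"
  shows "linear p"
proof (rule linearI)
  show "p (x + y) = p x + p y" for x y
    using sublinear_add[OF p, of x y] sublinear_add[OF p, of "- x" "- y"] odd[of "x + y"]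
    by (simp add: odd)
  have "p (c *\<^sub>R x) = c * p x" for c x
  proof (cases c "0 :: real" rule: linorder_cases)
    case less
    then show ?thesis using sublinear_scaleR[OF p, of "- c" x] odd[of "c *\<^sub>R x"] by simp
  qed (use sublinear_scaleR[OF p] sublinear_zero[OF p] in auto)
  then show "p (c *\<^sub>R x) = c *\<^sub>R p x" for c x by simp
qed

text \<open>An element \<open>(w, s)\<close> of the cone stands for the constraint \<open>g w \<le> s\<close> on a functional \<open>g\<close>. The
  infimal convolution below is the largest sublinear functional under \<open>p\<close> that obeys all the
  constraints; the hypothesis on the cone, applied to \<open>v - w\<close> and \<open>- v\<close>, keeps the infimum finite.\<close>

lemma sublinear_below_cone:
  fixes p :: "'v::real_vector \<Rightarrow> real"
  assumes p: "sublinear p"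
    and zero: "(0, 0) \<in> C"
    and add: "\<And>w s w' s'. (w, s) \<in> C \<Longrightarrow> (w', s') \<in> C \<Longrightarrow> (w + w', s + s') \<in> C"
    and scale: "\<And>c w s. c > 0 \<Longrightarrow> (w, s) \<in> C \<Longrightarrow> (c *\<^sub>R w, c * s) \<in> C"
    and compat: "\<And>w s. (w, s) \<in> C \<Longrightarrow> 0 \<le> p (- w) + s"
  obtains q where "sublinear q" and "q \<le> p" and "\<And>w s. (w, s) \<in> C \<Longrightarrow> q w \<le> s"
proof
  define r where "r v = (INF (w, s)\<in>C. p (v - w) + s)" for v
  have bdd: "bdd_below ((\<lambda>(w, s). p (v - w) + s) ` C)" for v
  proof (rule bdd_belowI2[where m = "- p (- v)"], clarify)
    fix w s assume "(w, s) \<in> C"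
    then show "- p (- v) \<le> p (v - w) + s"
      using sublinear_add[OF p, of "v - w" "- v"] compat by fastforce
  qed
  have le: "r v \<le> p (v - w) + s" if "(w, s) \<in> C" for v w s
    unfolding r_def using cINF_lower[OF bdd that] by simp
  have ge: "m \<le> r v" if "\<And>w s. (w, s) \<in> C \<Longrightarrow> m \<le> p (v - w) + s" for v m
    unfolding r_def using zero that by (intro cINF_greatest) auto
  show "sublinear r"
    unfolding sublinear_def
  proof (intro conjI allI impI)
    fix x y
    have *: "r (x + y) \<le> (p (x - w) + s) + (p (y - w') + s')"
      if "(w, s) \<in> C" "(w', s') \<in> C" for w s w' s'
      using le[OF add[OF that], of "x + y"] sublinear_add[OF p, of "x - w" "y - w'"]
      by (simp add: algebra_simps)
    have "r (x + y) - (p (x - w) + s) \<le> r y" if "(w, s) \<in> C" for w s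
      using *[OF that] by (intro ge) (simp add: algebra_simps)
    then have "r (x + y) - r y \<le> r x" by (intro ge) (simp add: algebra_simps)
    then show "r (x + y) \<le> r x + r y" by simp
  next
    fix c :: real and x assume c: "c > 0"
    have "r (c *\<^sub>R x) \<le> c * (p (x - w) + s)" if "(w, s) \<in> C" for w s
      using le[OF scale[OF c that], of "c *\<^sub>R x"] sublinear_scaleR[OF p c, of "x - w"]
      by (simp add: algebra_simps)
    then have "r (c *\<^sub>R x) / c \<le> r x"
      using c by (intro ge) (simp add: field_simps)
    then show "r (c *\<^sub>R x) \<le> c * r x" using c by (simp add: field_simps)
  qed
  show "r \<le> p" using le[OF zero] by (simp add: le_fun_def)
  show "r w \<le> s" if "(w, s) \<in> C" for w s
    using le[OF that, of w] sublinear_zero[OF p] by simp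
qed

text \<open>In a chain, any two members have a smaller one among them, so the pointwise infimum is again
  subadditive.\<close>

lemma sublinear_chain_lower_bound:
  fixes p :: "'v::real_vector \<Rightarrow> real"
  assumes "K \<noteq> {}" and sub: "\<And>q. q \<in> K \<Longrightarrow> sublinear q \<and> q \<le> p"
    and chain: "\<And>q q'. q \<in> K \<Longrightarrow> q' \<in> K \<Longrightarrow> q \<le> q' \<or> q' \<le> q"
  obtains r where "sublinear r" and "\<And>q. q \<in> K \<Longrightarrow> r \<le> q"
proof
  define r where "r v = (INF q\<in>K. q v)" for v
  have bdd: "bdd_below ((\<lambda>q. q v) ` K)" for v
  proof (rule bdd_belowI2)
    show "- p (- v) \<le> q v" if "q \<in> K" for q
    proof -
      have "q (- v) \<le> p (- v)" using sub[OF that] by (simp add: le_fun_def)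
      then show ?thesis using sub[OF that] sublinear_minus[of q v] by simp
    qed
  qed
  have le: "r v \<le> q v" if "q \<in> K" for v q
    unfolding r_def using cINF_lower[OF bdd that] .
  have ge: "m \<le> r v" if "\<And>q. q \<in> K \<Longrightarrow> m \<le> q v" for v m
    unfolding r_def using assms(1) that by (intro cINF_greatest)
  show "sublinear r"
    unfolding sublinear_def
  proof (intro conjI allI impI)
    fix x y
    have *: "r (x + y) \<le> q x + q' y" if q: "q \<in> K" "q' \<in> K" for q q'
    proof -
      obtain s where s: "s \<in> K" "s \<le> q" "s \<le> q'" using chain[OF q] q by blast
      have "r (x + y) \<le> s x + s y"
        using le[OF s(1), of "x + y"] sublinear_add[of s x y] sub[OF s(1)] by simp
      also have "\<dots> \<le> q x + q' y" using s(2,3) by (intro add_mono) (auto simp: le_fun_def)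
      finally show ?thesis .
    qed
    have "r (x + y) - q x \<le> r y" if "q \<in> K" for q
      using *[OF that] by (intro ge) (simp add: algebra_simps)
    then have "r (x + y) - r y \<le> r x" by (intro ge) (simp add: algebra_simps)
    then show "r (x + y) \<le> r x + r y" by simp
  next
    fix c :: real and x assume c: "c > 0"
    have "r (c *\<^sub>R x) \<le> c * q x" if "q \<in> K" for q
      using le[OF that, of "c *\<^sub>R x"] sublinear_scaleR_le[of q c x] sub[OF that] c by simp
    then have "r (c *\<^sub>R x) / c \<le> r x"
      using c by (intro ge) (simp add: field_simps)
    then show "r (c *\<^sub>R x) \<le> c * r x" using c by (simp add: field_simps)
  qed
  show "r \<le> q" if "q \<in> K" for q using le[OF that] by (simp add: le_fun_def)
qed

text \<open>The cone generated by \<open>(- b, - q b)\<close> imposes \<open>q' (- b) \<le> - q b\<close> on some sublinear \<open>q' \<le> q\<close>.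
  If \<open>q\<close> is minimal then \<open>q' = q\<close>, so \<open>q\<close> is odd; and odd sublinear functionals are linear.\<close>

lemma minimal_sublinear_imp_linear:
  fixes q :: "'v::real_vector \<Rightarrow> real"
  assumes q: "sublinear q" and min: "\<And>q'. sublinear q' \<Longrightarrow> q' \<le> q \<Longrightarrow> q' = q"
  shows "linear q"
proof (rule sublinear_odd_imp_linear[OF q])
  fix b
  define C where "C = {(- (t *\<^sub>R b), - (t * q b)) |t. t \<ge> 0}"
  have C: "(- (t *\<^sub>R b), - (t * q b)) \<in> C" if "t \<ge> 0" for t
    using that unfolding C_def by blast
  have CE: "\<exists>t. w = - (t *\<^sub>R b) \<and> s = - (t * q b) \<and> t \<ge> 0" if "(w, s) \<in> C" for w s
    using that unfolding C_def by blast
  have C_zero: "(0, 0) \<in> C" using C[of 0] by simp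
  have C_add: "(w + w', s + s') \<in> C" if wC: "(w, s) \<in> C" "(w', s') \<in> C" for w s w' s'
  proof -
    obtain t u where t: "w = - (t *\<^sub>R b)" "s = - (t * q b)" "t \<ge> 0"
      "w' = - (u *\<^sub>R b)" "s' = - (u * q b)" "u \<ge> 0"
      using CE[OF wC(1)] CE[OF wC(2)] by blast
    then show ?thesis using C[of "t + u"] by (simp add: algebra_simps)
  qed
  have C_scale: "(c *\<^sub>R w, c * s) \<in> C" if c: "c > 0" and wC: "(w, s) \<in> C" for c w s
  proof -
    obtain t where "w = - (t *\<^sub>R b)" "s = - (t * q b)" "t \<ge> 0"
      using CE[OF wC] by blast
    then show ?thesis using C[of "c * t"] c by (simp add: mult.assoc)
  qed
  have C_compat: "0 \<le> q (- w) + s" if wC: "(w, s) \<in> C" for w s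
  proof -
    obtain t where "w = - (t *\<^sub>R b)" "s = - (t * q b)" "t \<ge> 0"
      using CE[OF wC] by blast
    then show ?thesis
      using sublinear_scaleR[OF q, of t b] sublinear_zero[OF q] by (cases "t = 0") auto
  qed
  obtain q' where q': "sublinear q'" "q' \<le> q"
    and q'_C: "\<And>w s. (w, s) \<in> C \<Longrightarrow> q' w \<le> s"
    using sublinear_below_cone[OF q C_zero C_add C_scale C_compat] by blast
  have "(- b, - q b) \<in> C" using C[of 1] by simp
  then have "q (- b) \<le> - q b" using q'_C min[OF q'] by blast
  then show "q (- b) = - q b" using sublinear_minus[OF q, of b] by simp
qed

lemma linear_below_sublinear:
  fixes p :: "'v::real_vector \<Rightarrow> real"
  assumes p: "sublinear p"
  obtains g where "linear g" and "g \<le> p"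
proof -
  define A where "A = {q. sublinear q \<and> q \<le> p}"
  have "partial_order_on A (relation_of (\<lambda>q q'. q' \<le> q) A)"
    by (rule partial_order_on_relation_ofI) auto
  moreover have "\<exists>u\<in>A. \<forall>q\<in>K. u \<le> q" if K: "K \<in> Chains (relation_of (\<lambda>q q'. q' \<le> q) A)" for K
  proof (cases "K = {}")
    case True
    then show ?thesis using p by (auto simp: A_def)
  next
    case False
    have KA: "q \<in> A" if "q \<in> K" for q
      using K that by (auto simp: Chains_def relation_of_def)
    have "q \<le> q' \<or> q' \<le> q" if "q \<in> K" "q' \<in> K" for q q'
      using K that by (auto simp: Chains_def relation_of_def)
    then obtain r where r: "sublinear r" "\<And>q. q \<in> K \<Longrightarrow> r \<le> q"
      using sublinear_chain_lower_bound[OF False, of p] KA unfolding A_def by blast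
    moreover have "r \<le> p" using False KA r(2) by (fastforce simp: A_def intro: order_trans)
    ultimately show ?thesis by (auto simp: A_def)
  qed
  ultimately obtain q where q: "q \<in> A" "\<And>q'. q' \<in> A \<Longrightarrow> q' \<le> q \<Longrightarrow> q' = q"
    using predicate_Zorn[of A "\<lambda>q q'. q' \<le> q"] by blast
  have "linear q"
  proof (rule minimal_sublinear_imp_linear)
    show "sublinear q" using q(1) by (simp add: A_def)
    show "q' = q" if "sublinear q'" "q' \<le> q" for q'
    proof (rule q(2)[OF _ that(2)])
      have "q' \<le> p" using that(2) q(1) unfolding A_def by (blast intro: order_trans)
      then show "q' \<in> A" using that(1) by (simp add: A_def)
    qed
  qed
  moreover have "q \<le> p" using q(1) by (simp add: A_def)
  ultimately show thesis by (rule that)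
qed

theorem Hahn_Banach_cone:
  fixes p :: "'v::real_vector \<Rightarrow> real"
  assumes "sublinear p"
    and "(0, 0) \<in> C"
    and "\<And>w s w' s'. (w, s) \<in> C \<Longrightarrow> (w', s') \<in> C \<Longrightarrow> (w + w', s + s') \<in> C"
    and "\<And>c w s. c > 0 \<Longrightarrow> (w, s) \<in> C \<Longrightarrow> (c *\<^sub>R w, c * s) \<in> C"
    and "\<And>w s. (w, s) \<in> C \<Longrightarrow> 0 \<le> p (- w) + s"
  obtains g where "linear g" and "g \<le> p" and "\<And>w s. (w, s) \<in> C \<Longrightarrow> g w \<le> s"
proof -
  obtain q where q: "sublinear q" "q \<le> p" "\<And>w s. (w, s) \<in> C \<Longrightarrow> q w \<le> s"
    using sublinear_below_cone[OF assms] by blast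
  obtain g where g: "linear g" "g \<le> q" using linear_below_sublinear[OF q(1)] by blast
  show thesis
  proof
    show "g \<le> p" using g(2) q(2) by (rule order_trans)
    show "g w \<le> s" if "(w, s) \<in> C" for w s
      using q(3)[OF that] g(2) by (auto simp: le_fun_def intro: order_trans)
  qed (rule g(1))
qed

text \<open>The constraints say that \<open>f\<close> is nonpositive on \<open>S\<close>, hence zero since \<open>S\<close> is a subspace, and
  that \<open>f (- z) \<le> - \<epsilon>\<close>.\<close>

lemma Hahn_Banach_separation:
  fixes p :: "'v::real_vector \<Rightarrow> real"
  assumes p: "sublinear p" and nonneg: "\<And>x. p x \<ge> 0" and S: "subspace S"
    and far: "\<And>x. x \<in> S \<Longrightarrow> \<epsilon> \<le> p (z - x)"
  obtains f where "linear f" and "f \<le> p" and "\<And>x. x \<in> S \<Longrightarrow> f x = 0" and "\<epsilon> \<le> f z"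
proof -
  define C where "C = {(x - t *\<^sub>R z, - (t * \<epsilon>)) |x t. x \<in> S \<and> t \<ge> 0}"
  have C: "(x - t *\<^sub>R z, - (t * \<epsilon>)) \<in> C" if "x \<in> S" "t \<ge> 0" for x t
    using that unfolding C_def by blast
  have CE: "\<exists>x t. w = x - t *\<^sub>R z \<and> s = - (t * \<epsilon>) \<and> x \<in> S \<and> t \<ge> 0" if "(w, s) \<in> C" for w s
    using that unfolding C_def by blast
  have C_zero: "(0, 0) \<in> C" using C[OF subspace_0[OF S], of 0] by simp
  have C_add: "(w + w', s + s') \<in> C" if wC: "(w, s) \<in> C" "(w', s') \<in> C" for w s w' s'
  proof -
    obtain x t x' t' where w: "w = x - t *\<^sub>R z" "s = - (t * \<epsilon>)" "x \<in> S" "t \<ge> 0"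
      "w' = x' - t' *\<^sub>R z" "s' = - (t' * \<epsilon>)" "x' \<in> S" "t' \<ge> 0"
      using CE[OF wC(1)] CE[OF wC(2)] by blast
    have "(x + x' - (t + t') *\<^sub>R z, - ((t + t') * \<epsilon>)) \<in> C"
      using w by (intro C subspace_add[OF S]) auto
    then show ?thesis unfolding w(1,2,5,6) by (simp add: algebra_simps)
  qed
  have C_scale: "(c *\<^sub>R w, c * s) \<in> C" if c: "c > 0" and wC: "(w, s) \<in> C" for c w s
  proof -
    obtain x t where w: "w = x - t *\<^sub>R z" "s = - (t * \<epsilon>)" "x \<in> S" "t \<ge> 0"
      using CE[OF wC] by blast
    have "(c *\<^sub>R x - (c * t) *\<^sub>R z, - ((c * t) * \<epsilon>)) \<in> C"
      using w c by (intro C subspace_scale[OF S]) auto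
    then show ?thesis unfolding w(1,2) by (simp add: algebra_simps)
  qed
  have C_compat: "0 \<le> p (- w) + s" if wC: "(w, s) \<in> C" for w s
  proof -
    obtain x t where w: "w = x - t *\<^sub>R z" "s = - (t * \<epsilon>)" "x \<in> S" "t \<ge> 0"
      using CE[OF wC] by blast
    show ?thesis
    proof (cases "t = 0")
      case True
      then show ?thesis using w nonneg by simp
    next
      case False
      then have t: "t > 0" using w by simp
      have "\<epsilon> \<le> p (z - inverse t *\<^sub>R x)" using w by (intro far subspace_scale[OF S])
      then have "t * \<epsilon> \<le> t * p (z - inverse t *\<^sub>R x)" using t by simp
      also have "\<dots> = p (t *\<^sub>R (z - inverse t *\<^sub>R x))" using sublinear_scaleR[OF p t] by simp
      also have "t *\<^sub>R (z - inverse t *\<^sub>R x) = - w"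
        using t unfolding w(1) by (simp add: scaleR_diff_right)
      finally show ?thesis unfolding w(2) by simp
    qed
  qed
  obtain f where f: "linear f" "f \<le> p" "\<And>w s. (w, s) \<in> C \<Longrightarrow> f w \<le> s"
    using Hahn_Banach_cone[OF p C_zero C_add C_scale C_compat] by blast
  have le: "f x \<le> 0" if "x \<in> S" for x using f(3)[OF C[OF that, of 0]] by simp
  show thesis
  proof
    show "f x = 0" if "x \<in> S" for x
      using le[OF that] le[OF subspace_neg[OF S that]] linear_neg[OF f(1), of x] by simp
    show "\<epsilon> \<le> f z"
      using f(3)[OF C[OF subspace_0[OF S], of 1]] linear_neg[OF f(1), of z] by simp
  qed (use f in auto)
qed

text \<open>This replaces extension of \<open>f\<close> from the diagonal of a finite product, one factor at a time: the
  constraints on \<open>g j\<close> are that \<open>f - g j \<circ> T j\<close> is dominated by the sum over the other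
  indices (replace \<open>x\<close> by \<open>- x\<close>), to which the induction hypothesis applies.\<close>

lemma linear_dominated_by_sum_splits:
  fixes T :: "'i \<Rightarrow> 'v::real_vector \<Rightarrow> 'w::real_normed_vector"
  assumes "finite I" and "\<And>i. i \<in> I \<Longrightarrow> linear (T i)"
    and "linear f" and "\<And>x. f x \<le> (\<Sum>i\<in>I. norm (T i x))"
  shows "\<exists>g. (\<forall>i\<in>I. linear (g i) \<and> (\<forall>y. g i y \<le> norm y)) \<and> (\<forall>x. f x = (\<Sum>i\<in>I. g i (T i x)))"
  using assms
proof (induction I arbitrary: f rule: finite_induct)
  case empty
  have "f x = 0" for x
    using empty.prems(3)[of x] empty.prems(3)[of "- x"] linear_neg[OF empty.prems(2), of x]
    by simp
  then show ?case by simp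
next
  case (insert j I)
  note f = insert.prems(2)
  have Tj: "linear (T j)" using insert.prems(1) by simp
  define N where "N x = (\<Sum>i\<in>I. norm (T i x))" for x
  have N: "sublinear N"
    unfolding N_def by (intro sublinear_sum sublinear_norm_linear) (simp add: insert.prems(1))
  have N_minus: "N (- x) = N x" for x
    unfolding N_def by (intro sum.cong refl) (simp add: linear_neg[OF insert.prems(1)])
  have dom: "f x \<le> norm (T j x) + N x" for x
    using insert.prems(3)[of x] insert.hyps by (simp add: N_def)
  define C where "C = {(T j x, s) |x s. f x + N x \<le> s}"
  have C: "(T j x, s) \<in> C" if "f x + N x \<le> s" for x s using that unfolding C_def by blast
  have CE: "\<exists>x. w = T j x \<and> f x + N x \<le> s" if "(w, s) \<in> C" for w s
    using that unfolding C_def by blast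
  have C_zero: "(0, 0) \<in> C"
    using C[of 0 0] linear_0[OF f] linear_0[OF Tj] sublinear_zero[OF N] by simp
  have C_add: "(w + w', s + s') \<in> C" if wC: "(w, s) \<in> C" "(w', s') \<in> C" for w s w' s'
  proof -
    obtain x x' where w: "w = T j x" "f x + N x \<le> s" "w' = T j x'" "f x' + N x' \<le> s'"
      using CE[OF wC(1)] CE[OF wC(2)] by blast
    have "(T j (x + x'), s + s') \<in> C"
      using w sublinear_add[OF N, of x x'] by (intro C) (simp add: linear_add[OF f])
    then show ?thesis using w by (simp add: linear_add[OF Tj])
  qed
  have C_scale: "(c *\<^sub>R w, c * s) \<in> C" if c: "c > 0" and wC: "(w, s) \<in> C" for c w s
  proof -
    obtain x where w: "w = T j x" "f x + N x \<le> s" using CE[OF wC] by blast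
    have "c * (f x + N x) \<le> c * s" using w c by simp
    then have "(T j (c *\<^sub>R x), c * s) \<in> C"
      by (intro C) (simp add: linear_scale[OF f] sublinear_scaleR[OF N c] distrib_left)
    then show ?thesis using w by (simp add: linear_scale[OF Tj])
  qed
  have C_compat: "0 \<le> norm (- w) + s" if wC: "(w, s) \<in> C" for w s
  proof -
    obtain x where w: "w = T j x" "f x + N x \<le> s" using CE[OF wC] by blast
    have "- f x \<le> norm (T j x) + N x"
      using dom[of "- x"] by (simp add: linear_neg[OF f] linear_neg[OF Tj] N_minus)
    then show ?thesis using w by simp
  qed
  have norm: "sublinear (norm :: 'w \<Rightarrow> real)"
    using sublinear_norm_linear[OF linear_id] by (simp add: id_def)
  obtain h where h: "linear h" "h \<le> norm" "\<And>w s. (w, s) \<in> C \<Longrightarrow> h w \<le> s"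
    using Hahn_Banach_cone[OF norm C_zero C_add C_scale C_compat] by blast
  define f' where "f' x = f x - h (T j x)" for x
  have f': "linear f'"
    unfolding f'_def using linear_compose[OF Tj h(1)] f
    by (intro linear_compose_sub) (simp_all add: o_def)
  have f'_le: "f' x \<le> (\<Sum>i\<in>I. norm (T i x))" for x
    using h(3)[OF C[OF order_refl], of "- x"]
    by (simp add: f'_def linear_neg[OF f] linear_neg[OF Tj] linear_neg[OF h(1)] N_minus
        flip: N_def)
  obtain g where g: "\<And>i. i \<in> I \<Longrightarrow> linear (g i) \<and> (\<forall>y. g i y \<le> norm y)"
    "\<And>x. f' x = (\<Sum>i\<in>I. g i (T i x))"
    using insert.IH[OF insert.prems(1)[OF insertI2] f' f'_le] by blast
  have "f x = (\<Sum>i\<in>insert j I. (g(j := h)) i (T i x))" for x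
  proof -
    have "(\<Sum>i\<in>I. (g(j := h)) i (T i x)) = (\<Sum>i\<in>I. g i (T i x))"
      using insert.hyps(2) by (intro sum.cong refl) auto
    then show ?thesis using g(2)[of x] insert.hyps by (simp add: f'_def)
  qed
  then show ?case
    using g(1) h(1,2) by (intro exI[of _ "g(j := h)"]) (auto simp: le_fun_def)
qed

section \<open>Real functionals and the complex dual\<close>

text \<open>A complex functional is recovered from its real part \<open>\<phi>\<close> as
  \<open>y \<mapsto> \<phi> y - \<i> \<phi> (\<i> y)\<close>.\<close>

lemma real_functional_eq_Re_cdual:
  fixes \<phi> :: "'a::complex_normed_vector \<Rightarrow> real"
  assumes lin: "linear \<phi>" and le: "\<And>y. \<phi> y \<le> norm y"
  obtains f where "\<And>y. Re (cdual_apply f y) = \<phi> y"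
proof
  define \<Phi> where "\<Phi> y = Complex (\<phi> y) (- \<phi> (\<i> *\<^sub>C y))" for y
  have scale: "\<phi> (complex_of_real r *\<^sub>C y) = r * \<phi> y" for r y
    using linear_scale[OF lin, of r y] by (simp add: scaleR_scaleC)
  have "\<Phi> (c *\<^sub>C y) = c * \<Phi> y" for c y
  proof -
    have 1: "c *\<^sub>C y = complex_of_real (Re c) *\<^sub>C y + complex_of_real (Im c) *\<^sub>C \<i> *\<^sub>C y"
      unfolding scaleC_scaleC scaleC_add_left[symmetric]
      by (intro arg_cong[where f = "\<lambda>c. c *\<^sub>C y"]) (simp add: complex_eq_iff)
    have 2: "\<i> *\<^sub>C c *\<^sub>C y =
        complex_of_real (Re c) *\<^sub>C \<i> *\<^sub>C y + complex_of_real (- Im c) *\<^sub>C y"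
      unfolding scaleC_scaleC scaleC_add_left[symmetric]
      by (intro arg_cong[where f = "\<lambda>c. c *\<^sub>C y"]) (simp add: complex_eq_iff)
    have "\<phi> (c *\<^sub>C y) = Re c * \<phi> y + Im c * \<phi> (\<i> *\<^sub>C y)"
      by (subst 1) (simp only: linear_add[OF lin] scale)
    moreover have "\<phi> (\<i> *\<^sub>C c *\<^sub>C y) = Re c * \<phi> (\<i> *\<^sub>C y) - Im c * \<phi> y"
      by (subst 2) (simp only: linear_add[OF lin] scale)
    ultimately show ?thesis by (simp add: \<Phi>_def complex_eq_iff)
  qed
  moreover have "\<Phi> (x + y) = \<Phi> x + \<Phi> y" for x y
    by (simp add: \<Phi>_def scaleC_add_right linear_add[OF lin] complex_eq_iff)
  ultimately have "complex_linear_functional \<Phi>"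
    unfolding complex_linear_functional_def by blast
  moreover have "cmod (\<Phi> y) \<le> 2 * norm y" for y
  proof -
    have "\<bar>\<phi> y\<bar> \<le> norm y" for y
      using le[of y] le[of "- y"] linear_neg[OF lin, of y] by simp
    from this[of y] this[of "\<i> *\<^sub>C y"] show ?thesis
      using cmod_le[of "\<Phi> y"] by (simp add: \<Phi>_def norm_scaleC)
  qed
  ultimately have "cdual_apply (Cdual \<Phi>) = \<Phi>" by (rule cdual_apply_Cdual)
  then show "Re (cdual_apply (Cdual \<Phi>) y) = \<phi> y" for y by (simp add: \<Phi>_def)
qed

lemma cdual_eq_0_if_Re_eq_0:
  assumes "\<And>y. Re (cdual_apply f y) = 0"
  shows "f = 0"
proof (rule cdual_eqI)
  fix y
  have "Im (cdual_apply f y) = 0"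
    using assms[of "\<i> *\<^sub>C y"] by (simp add: cdual_simps)
  then show "cdual_apply f y = cdual_apply 0 y"
    using assms[of y] by (simp add: cdual_simps complex_eq_iff)
qed

lemma cdual_apply_sum_left: "cdual_apply (\<Sum>i\<in>I. f i) x = (\<Sum>i\<in>I. cdual_apply (f i) x)"
  by (induction I rule: infinite_finite_induct) (simp_all add: cdual_simps)

lemma cdual_apply_sum_right: "cdual_apply f (\<Sum>i\<in>I. x i) = (\<Sum>i\<in>I. cdual_apply f (x i))"
  by (induction I rule: infinite_finite_induct) (simp_all add: cdual_simps)

lemma linear_bidual_embed: "linear bidual_embed"
  by (rule linearI) (rule cdual_eqI; simp add: cdual_simps scaleR_scaleC)+

lemma norm_bidual_embed_le: "norm (bidual_embed x) \<le> norm x"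
  by (rule norm_cdual_bound) (simp_all add: norm_cdual_apply mult.commute[of "norm x"])

lemma linear_bidual_prod_left: "linear (\<lambda>x. x \<circ>\<^sub>B y)"
  by (rule linearI) (rule cdual_eqI; simp add: cdual_simps scaleR_scaleC)+

section \<open>J-strict density\<close>

lemma multiplier_J_strict_approximation:
  fixes z :: "'a::jb_star_algebra bidual"
  assumes z: "z \<in> multiplier_algebra" and F: "finite F" and "\<epsilon> > 0"
  obtains x where "(\<Sum>a\<in>F. norm ((z - bidual_embed x) \<circ>\<^sub>B bidual_embed a)) < \<epsilon>"
proof (rule ccontr)
  assume "\<not> thesis"
  then have far: "\<epsilon> \<le> (\<Sum>a\<in>F. norm ((z - bidual_embed x) \<circ>\<^sub>B bidual_embed a))" for x
    using that[of x] by (meson not_less)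
  have subspace: "subspace (range (bidual_embed :: 'a \<Rightarrow> 'a bidual))"
    using linear_subspace_image[OF linear_bidual_embed subspace_UNIV] .
  obtain f where f: "linear f" "f \<le> (\<lambda>u. \<Sum>a\<in>F. norm (u \<circ>\<^sub>B bidual_embed a))"
    and f0: "\<And>x. f (bidual_embed x) = 0" and fz: "\<epsilon> \<le> f z"
    by (rule Hahn_Banach_separation[OF _ _ subspace,
          where p = "\<lambda>u. \<Sum>a\<in>F. norm (u \<circ>\<^sub>B bidual_embed a)" and z = z and \<epsilon> = \<epsilon>])
      (use far in \<open>auto intro!: sublinear_sum sublinear_norm_linear linear_bidual_prod_left sum_nonneg\<close>)
  obtain g where g: "\<And>a. a \<in> F \<Longrightarrow> linear (g a)" "\<And>a y. a \<in> F \<Longrightarrow> g a y \<le> norm y"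
    and fg: "\<And>u. f u = (\<Sum>a\<in>F. g a (u \<circ>\<^sub>B bidual_embed a))"
    using linear_dominated_by_sum_splits[OF F linear_bidual_prod_left f(1), of bidual_embed]
      le_funD[OF f(2)] by blast
  have "\<exists>h. \<forall>y. Re (cdual_apply h y) = g a (bidual_embed y)" if a: "a \<in> F" for a
  proof (rule real_functional_eq_Re_cdual)
    show "linear (\<lambda>y. g a (bidual_embed y :: 'a bidual))"
      using linear_compose[OF linear_bidual_embed g(1)[OF a]] by (simp add: o_def)
    show "g a (bidual_embed y) \<le> norm y" for y
      using g(2)[OF a] norm_bidual_embed_le by (rule order_trans)
  qed blast
  then obtain h where h: "\<And>a y. a \<in> F \<Longrightarrow> Re (cdual_apply (h a) y) = g a (bidual_embed y)"
    by metis
  \<comment> \<open>The functional \<open>y \<mapsto> \<Sum>a\<in>F. h a (y \<circ> a)\<close>, whose real part on the algebra is \<open>f\<close>.\<close>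
  define \<psi> where "\<psi> = (\<Sum>a\<in>F. bidual_act (bidual_embed a) (h a))"
  have "Re (cdual_apply \<psi> y) = f (bidual_embed y)" for y
    by (simp add: \<psi>_def cdual_apply_sum_left fg h bidual_prod_embed)
  then have "\<psi> = 0" using f0 by (intro cdual_eq_0_if_Re_eq_0) simp
  have "g a (z \<circ>\<^sub>B bidual_embed a) = Re (cdual_apply z (bidual_act (bidual_embed a) (h a)))"
    if a: "a \<in> F" for a
  proof -
    \<comment> \<open>\<open>g a\<close> is given by \<open>h a\<close> on the algebra only, so the multiplier property is essential.\<close>
    obtain b where b: "z \<circ>\<^sub>B bidual_embed a = bidual_embed b"
      using z by (auto simp: multiplier_algebra_def)
    have "g a (z \<circ>\<^sub>B bidual_embed a) = Re (cdual_apply (bidual_embed b) (h a))"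
      by (simp add: b h[OF a])
    also have "\<dots> = Re (cdual_apply z (bidual_act (bidual_embed a) (h a)))"
      by (simp flip: b)
    finally show ?thesis .
  qed
  then have "f z = Re (cdual_apply z \<psi>)"
    by (simp add: fg \<psi>_def cdual_apply_sum_right)
  then show False using \<open>\<psi> = 0\<close> fz \<open>\<epsilon> > 0\<close> by (simp add: cdual_simps)
qed

theorem proposition2p1:
  shows "J_strict_topology closure_of range (bidual_embed :: 'a::jb_star_algebra \<Rightarrow> 'a bidual)
    = multiplier_algebra"
proof
  show "J_strict_topology closure_of range (bidual_embed :: 'a \<Rightarrow> 'a bidual) \<subseteq> multiplier_algebra"
    using closure_of_subset_topspace[of "J_strict_topology :: 'a bidual topology"]
    by (simp add: J_strict_topology_def)
next
  have "\<exists>y \<in> range bidual_embed. y \<in> U"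
    if z: "z \<in> U" and U: "openin J_strict_topology U" for z :: "'a bidual" and U
  proof -
    have zM: "z \<in> multiplier_algebra"
      using U z by (auto simp: J_strict_topology_def openin_seminorm_topology_on)
    obtain F \<epsilon> where F: "finite F" "\<epsilon> > 0"
      and sub: "{y \<in> multiplier_algebra. \<forall>a\<in>F. norm ((y - z) \<circ>\<^sub>B bidual_embed a) < \<epsilon>} \<subseteq> U"
      using U z unfolding J_strict_topology_def openin_seminorm_topology_on by meson
    obtain x where x: "(\<Sum>a\<in>F. norm ((z - bidual_embed x) \<circ>\<^sub>B bidual_embed a)) < \<epsilon>"
      using multiplier_J_strict_approximation[OF zM F] .
    have "norm ((bidual_embed x - z) \<circ>\<^sub>B bidual_embed a) < \<epsilon>" if a: "a \<in> F" for a
    proof -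
      have "norm ((bidual_embed x - z) \<circ>\<^sub>B bidual_embed a)
          = norm ((z - bidual_embed x) \<circ>\<^sub>B bidual_embed a)"
        by (simp add: linear_diff[OF linear_bidual_prod_left] norm_minus_commute)
      also have "\<dots> \<le> (\<Sum>a\<in>F. norm ((z - bidual_embed x) \<circ>\<^sub>B bidual_embed a))"
        using a F(1) by (intro member_le_sum) auto
      finally show ?thesis using x by simp
    qed
    then have "bidual_embed x \<in> U"
      using sub range_bidual_embed_subset_multiplier_algebra by blast
    then show ?thesis by blast
  qed
  then show "multiplier_algebra \<subseteq> J_strict_topology closure_of range (bidual_embed :: 'a \<Rightarrow> 'a bidual)"
    by (auto simp: in_closure_of J_strict_topology_def)
qed

end
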